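(* Let $\mathcal I,\mathcal J$ be ideals on an infinite set $X$. (a) If $\mathcal J$ is maximal, then $\mathtt{cof}^{\mathcal J}(\mathcal I)=1$. (b) If $\mathcal I$ is maximal, then the following conditions are equivalent: (i) $\mathtt{cof}^{\mathcal J}(\mathcal I)=1$; (ii) $\mathtt{cof}^{\mathcal J}(\mathcal I)\le\omega$; (iii) $\mathcal I\subseteq^{\restriction}\mathcal J$; (iv) $\mathcal J\nsubseteq\mathcal I$ or $\mathcal I\subseteq^{\restriction}\mathcal J$; (v) $\mathcal J\nsubseteq\mathcal I$, or both $\mathcal J\subseteq\mathcal I$ and $\mathcal I\subseteq^{\restriction}\mathcal J$.
   Context: An ideal on an infinite set $X$ is a family $\mathcal I\subseteq\mathcal P(X)$ closed under subsets and finite unions, with $X\notin\mathcal I$ and $[X]^{<\omega}\subseteq\mathcal I$; by convention $\{\emptyset\}$ is also regarded as an ideal on $X$. Maximal means maximal under inclusion among ideals on $X$. $\mathcal I^*=\{X\setminus I:I\in\mathcal I\}$ and $\mathcal I{\restriction}E=\{I\cap E:I\in\mathcal I\}$. $\mathcal I\subseteq^{\restriction}\mathcal J$ means that there is $E\in\mathcal I^*$ such that $\mathcal I{\restriction}E\subseteq\mathcal J$. $\mathtt{cof}^{\mathcal J}(\mathcal I)=\min\{|\mathcal A|:\mathcal A\subseteq\mathcal I,\ \forall I\in\mathcal I\ \exists A\in\mathcal A\ I\setminus A\in\mathcal J\}$. *)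

theory Defs
  imports Main
begin

unbundle cardinal_syntax

text \<open>
  Ideals on the carrier set \<open>X\<close>. A genuine ideal is proper and contains all finite subsets of
  \<open>X\<close>; by convention \<open>{{}}\<close> counts as an ideal as well.
\<close>

definition ideal_on :: "'a set \<Rightarrow> 'a set set \<Rightarrow> bool" where
  "ideal_on X \<I> \<longleftrightarrow>
     \<I> = {{}} \<or>
     (\<I> \<subseteq> Pow X \<and>
      (\<forall>A\<in>\<I>. \<forall>B. B \<subseteq> A \<longrightarrow> B \<in> \<I>) \<and>
      (\<forall>A\<in>\<I>. \<forall>B\<in>\<I>. A \<union> B \<in> \<I>) \<and>
      X \<notin> \<I> \<and>
      (\<forall>F. F \<subseteq> X \<and> finite F \<longrightarrow> F \<in> \<I>))"

definition maximal_ideal_on :: "'a set \<Rightarrow> 'a set set \<Rightarrow> bool" where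
  "maximal_ideal_on X \<I> \<longleftrightarrow>
     ideal_on X \<I> \<and> (\<forall>\<J>. ideal_on X \<J> \<and> \<I> \<subseteq> \<J> \<longrightarrow> \<J> = \<I>)"

definition dual_filter :: "'a set \<Rightarrow> 'a set set \<Rightarrow> 'a set set" where
  "dual_filter X \<I> = {X - A | A. A \<in> \<I>}"

definition restr :: "'a set set \<Rightarrow> 'a set \<Rightarrow> 'a set set" where
  "restr \<I> E = {A \<inter> E | A. A \<in> \<I>}"

definition restr_subset :: "'a set \<Rightarrow> 'a set set \<Rightarrow> 'a set set \<Rightarrow> bool" where
  "restr_subset X \<I> \<J> \<longleftrightarrow> (\<exists>E\<in>dual_filter X \<I>. restr \<I> E \<subseteq> \<J>)"

definition cofinal_mod :: "'a set set \<Rightarrow> 'a set set \<Rightarrow> 'a set set \<Rightarrow> bool" where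
  "cofinal_mod \<J> \<I> \<A> \<longleftrightarrow> \<A> \<subseteq> \<I> \<and> (\<forall>I\<in>\<I>. \<exists>A\<in>\<A>. I - A \<in> \<J>)"

text \<open>
  Cardinals are represented as in the BNF cardinal library, by well-order relations compared
  with \<open>\<le>o\<close> and \<open>=o\<close>. The minimum of a set of cardinals is unique only up to \<open>=o\<close>,
  so \<open>cof\<close> should be used only up to \<open>=o\<close>.
\<close>

definition cof :: "'a set set \<Rightarrow> 'a set set \<Rightarrow> 'a set rel" where
  "cof \<J> \<I> =
     (SOME r. r \<in> {|\<A>| | \<A>. cofinal_mod \<J> \<I> \<A>} \<and>
              (\<forall>r'\<in>{|\<A>| | \<A>. cofinal_mod \<J> \<I> \<A>}. r \<le>o r'))"

lemma ideal_on_empty: "ideal_on X \<I> \<Longrightarrow> {} \<in> \<I>"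
  unfolding ideal_on_def by auto

lemma cof_attained:
  assumes "ideal_on X \<J>"
  shows "\<exists>\<A>. cofinal_mod \<J> \<I> \<A> \<and> cof \<J> \<I> = |\<A>|"
    and "cofinal_mod \<J> \<I> \<B> \<Longrightarrow> cof \<J> \<I> \<le>o |\<B>|"
proof -
  let ?R = "{|\<A>| | \<A>. cofinal_mod \<J> \<I> \<A>}"
  have "cofinal_mod \<J> \<I> \<I>"
    using ideal_on_empty[OF assms] unfolding cofinal_mod_def by (metis Diff_cancel order_refl)
  then have "?R \<noteq> {}" by blast
  moreover have "\<forall>r\<in>?R. Card_order r" using card_of_Card_order by blast
  ultimately have "\<exists>r. r \<in> ?R \<and> (\<forall>r'\<in>?R. r \<le>o r')"
    using exists_minim_Card_order[of ?R] by blast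
  from someI_ex[OF this]
  have c: "cof \<J> \<I> \<in> ?R \<and> (\<forall>r'\<in>?R. cof \<J> \<I> \<le>o r')"
    unfolding cof_def .
  then show "\<exists>\<A>. cofinal_mod \<J> \<I> \<A> \<and> cof \<J> \<I> = |\<A>|" by blast
  show "cofinal_mod \<J> \<I> \<B> \<Longrightarrow> cof \<J> \<I> \<le>o |\<B>|" using c by blast
qed

end

theory Submission
  imports Defs
begin

text \<open>
  A set \<open>A\<close> with \<open>{A}\<close> cofinal modulo \<open>\<J>\<close> is the same as a witness \<open>X - A\<close> of
  \<open>restr_subset\<close>. If some set outside a maximal \<open>\<I>\<close> lies in \<open>\<J>\<close>, its complement is such an \<open>A\<close>;
  dually for a maximal \<open>\<J>\<close>. The main point is that no countably infinite family can be
  minimal: otherwise one finds an increasing cofinal sequence in \<open>\<I>\<close> whose consecutive differences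
  are outside \<open>\<J>\<close>. The union of the even differences or that of the odd ones belongs to the maximal
  ideal \<open>\<I>\<close>, and it is not contained modulo \<open>\<J>\<close> in any term of the sequence.
\<close>

lemma ideal_on_subset: "ideal_on X \<I> \<Longrightarrow> A \<in> \<I> \<Longrightarrow> B \<subseteq> A \<Longrightarrow> B \<in> \<I>"
  unfolding ideal_on_def by auto

lemma ideal_on_Un: "ideal_on X \<I> \<Longrightarrow> A \<in> \<I> \<Longrightarrow> B \<in> \<I> \<Longrightarrow> A \<union> B \<in> \<I>"
  unfolding ideal_on_def by auto

lemma ideal_on_carrier: "ideal_on X \<I> \<Longrightarrow> A \<in> \<I> \<Longrightarrow> A \<subseteq> X"
  unfolding ideal_on_def by auto

lemma ideal_on_UN_atMost:
  fixes g :: "nat \<Rightarrow> 'a set"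
  assumes "ideal_on X \<I>" "\<And>i. g i \<in> \<I>"
  shows "(\<Union>i\<le>n. g i) \<in> \<I>"
  by (induction n) (simp_all add: assms atMost_Suc ideal_on_Un[OF assms(1)])

lemma ideal_on_finite_subsets: "infinite X \<Longrightarrow> ideal_on X {F. F \<subseteq> X \<and> finite F}"
  unfolding ideal_on_def by (auto intro: finite_subset)

text \<open>The convention admits \<open>{{}}\<close> as an ideal, but on an infinite set the finite
  subsets form a strictly larger one. Hence a maximal ideal contains all finite subsets.\<close>

lemma maximal_ideal_on_nontrivial:
  assumes "infinite X" "maximal_ideal_on X \<I>"
  shows "\<I> \<noteq> {{}}"
proof
  assume "\<I> = {{}}"
  then have "{F. F \<subseteq> X \<and> finite F} = {{}}"
    using assms ideal_on_finite_subsets[OF assms(1)] unfolding maximal_ideal_on_def by blast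
  moreover obtain x where "x \<in> X"
    using assms(1) by fastforce
  then have "{x} \<in> {F. F \<subseteq> X \<and> finite F}"
    by simp
  ultimately show False
    by blast
qed

text \<open>Otherwise adjoining \<open>A\<close> to \<open>\<I>\<close> would give a strictly larger
  proper ideal.\<close>

lemma maximal_ideal_on_compl:
  assumes "infinite X" "maximal_ideal_on X \<I>" "A \<subseteq> X" "A \<notin> \<I>"
  shows "X - A \<in> \<I>"
proof (rule ccontr)
  assume compl: "X - A \<notin> \<I>"
  \<comment> \<open>This is the ideal generated by \<open>\<I>\<close> and \<open>A\<close>; that
    \<open>X\<close> is not in it is exactly \<open>X - A \<notin> \<I>\<close>.\<close>
  let ?K = "{B. B \<subseteq> X \<and> B - A \<in> \<I>}"
  have I: "ideal_on X \<I>"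
    using assms(2) unfolding maximal_ideal_on_def by blast
  have fin: "F \<in> \<I>" if "F \<subseteq> X" "finite F" for F
    using I maximal_ideal_on_nontrivial[OF assms(1,2)] that unfolding ideal_on_def by blast
  have "ideal_on X ?K"
    unfolding ideal_on_def
  proof (intro disjI2 conjI ballI allI impI)
    fix B C assume "B \<in> ?K" "C \<subseteq> B"
    then show "C \<in> ?K"
      using ideal_on_subset[OF I, of "B - A" "C - A"] by blast
  next
    fix B C assume "B \<in> ?K" "C \<in> ?K"
    then show "B \<union> C \<in> ?K"
      using ideal_on_Un[OF I, of "B - A" "C - A"] by (simp add: Un_Diff)
  next
    fix F assume "F \<subseteq> X \<and> finite F"
    then show "F \<in> ?K"
      using fin[of "F - A"] by blast
  qed (use compl in auto)
  moreover have "\<I> \<subseteq> ?K"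
    using ideal_on_subset[OF I] ideal_on_carrier[OF I] by blast
  ultimately have "?K = \<I>"
    using assms(2) unfolding maximal_ideal_on_def by blast
  moreover have "A \<in> ?K"
    using assms(3) ideal_on_empty[OF I] by simp
  ultimately show False
    using assms(4) by blast
qed

lemma cofinal_mod_singleton: "cofinal_mod \<J> \<I> {A} \<longleftrightarrow> A \<in> \<I> \<and> (\<forall>B\<in>\<I>. B - A \<in> \<J>)"
  unfolding cofinal_mod_def by simp

text \<open>Members of \<open>\<I>\<close> lie in \<open>X\<close>, so the trace of \<open>B\<close>
  on \<open>X - A\<close> is \<open>B - A\<close>.\<close>

lemma restr_subset_iff_cofinal_singleton:
  assumes "ideal_on X \<I>"
  shows "restr_subset X \<I> \<J> \<longleftrightarrow> (\<exists>A. cofinal_mod \<J> \<I> {A})"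
proof -
  have "B \<inter> (X - A) = B - A" if "B \<in> \<I>" for A B
    using ideal_on_carrier[OF assms that] by blast
  then have "restr \<I> (X - A) = (\<lambda>B. B - A) ` \<I>" for A
    unfolding restr_def by (simp add: setcompr_eq_image)
  moreover have "restr_subset X \<I> \<J> \<longleftrightarrow> (\<exists>A\<in>\<I>. restr \<I> (X - A) \<subseteq> \<J>)"
    unfolding restr_subset_def dual_filter_def by blast
  ultimately show ?thesis
    unfolding cofinal_mod_singleton by (simp add: image_subset_iff Bex_def)
qed

lemma cofinal_mod_nonempty: "ideal_on X \<I> \<Longrightarrow> cofinal_mod \<J> \<I> \<A> \<Longrightarrow> \<A> \<noteq> {}"
  using ideal_on_empty unfolding cofinal_mod_def by blast

lemma cof_eq_cone:
  assumes "ideal_on X \<I>" "ideal_on X \<J>" "cofinal_mod \<J> \<I> {A}"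
  shows "cof \<J> \<I> =o cone"
proof -
  obtain \<A> where A: "cofinal_mod \<J> \<I> \<A>" "cof \<J> \<I> = |\<A>|"
    using cof_attained(1)[OF assms(2)] by blast
  have "cone \<le>o |\<A>|"
    using cofinal_mod_nonempty[OF assms(1) A(1)] unfolding cone_def
    by (simp add: card_of_singl_ordLeq)
  moreover have "|{A}| \<le>o cone"
    unfolding cone_def by (rule card_of_singl_ordLeq) simp
  then have "cof \<J> \<I> \<le>o cone"
    by (rule ordLeq_transitive[OF cof_attained(2)[OF assms(2,3)]])
  ultimately show ?thesis
    unfolding ordIso_iff_ordLeq A(2) by blast
qed

text \<open>A nonempty countable family is the range of a sequence; repetitions are allowed, so
  finite families are covered too.\<close>

lemma cofinal_mod_sequence:
  assumes "ideal_on X \<I>" "ideal_on X \<J>" "cof \<J> \<I> \<le>o natLeq"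
  obtains g :: "nat \<Rightarrow> 'a set" where "cofinal_mod \<J> \<I> (range g)"
proof -
  obtain \<A> where A: "cofinal_mod \<J> \<I> \<A>" "cof \<J> \<I> = |\<A>|"
    using cof_attained(1)[OF assms(2)] by blast
  have "|\<A>| \<le>o |UNIV :: nat set|"
    using ordLeq_ordIso_trans[OF assms(3) ordIso_symmetric[OF card_of_nat]] unfolding A(2) .
  then obtain g :: "nat \<Rightarrow> 'a set" where "range g = \<A>"
    using card_of_ordLeq2[OF cofinal_mod_nonempty[OF assms(1) A(1)], where B = "UNIV :: nat set"]
    by auto
  with A(1) have "cofinal_mod \<J> \<I> (range g)"
    by simp
  then show ?thesis
    by (rule that)
qed

lemma cofinal_mod_sequence_collapses:
  fixes g :: "nat \<Rightarrow> 'a set"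
  assumes "infinite X" "maximal_ideal_on X \<I>" "ideal_on X \<J>" "cofinal_mod \<J> \<I> (range g)"
  shows "\<exists>A. cofinal_mod \<J> \<I> {A}"
proof (rule ccontr)
  assume no: "\<nexists>A. cofinal_mod \<J> \<I> {A}"
  have I: "ideal_on X \<I>"
    using assms(2) unfolding maximal_ideal_on_def by blast
  have g: "g i \<in> \<I>" for i
    using assms(4) unfolding cofinal_mod_def by blast
  have cofin: "\<exists>k. B - g k \<in> \<J>" if "B \<in> \<I>" for B
    using assms(4) that unfolding cofinal_mod_def by blast
  \<comment> \<open>Finite unions make the sequence increasing without leaving
    \<open>\<I>\<close>.\<close>
  define a where "a n = (\<Union>i\<le>n. g i)" for n
  have a: "a n \<in> \<I>" for n
    unfolding a_def by (rule ideal_on_UN_atMost[OF I g])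
  have mono: "a m \<subseteq> a n" if "m \<le> n" for m n
    using that unfolding a_def by force
  have ga: "g n \<subseteq> a n" for n
    unfolding a_def by blast
  \<comment> \<open>Since \<open>{a n}\<close> is not cofinal, some \<open>B\<close> in
    \<open>\<I>\<close> escapes \<open>a n\<close> modulo \<open>\<J>\<close>. Some
    \<open>g k\<close> captures \<open>B\<close> modulo \<open>\<J>\<close>, so any
    \<open>a m\<close> containing \<open>g k\<close> must exceed \<open>a n\<close> by a set outside
    \<open>\<J>\<close>.\<close>
  have "\<exists>m>n. a m - a n \<notin> \<J>" for n
  proof -
    obtain B where B: "B \<in> \<I>" "B - a n \<notin> \<J>"
      using no a[of n] unfolding cofinal_mod_singleton by blast
    obtain k where k: "B - g k \<in> \<J>"
      using cofin[OF B(1)] by blast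
    define m where "m = max k (Suc n)"
    have "g k \<subseteq> a m"
      using ga[of k] mono[of k m] unfolding m_def by auto
    then have "B - a n \<subseteq> (B - g k) \<union> (a m - a n)"
      by blast
    then have "a m - a n \<notin> \<J>"
      using ideal_on_Un[OF assms(3) k] ideal_on_subset[OF assms(3)] B(2) by blast
    moreover have "n < m"
      unfolding m_def by simp
    ultimately show ?thesis
      by blast
  qed
  then obtain f where f: "f n > n" "a (f n) - a n \<notin> \<J>" for n
    by metis
  \<comment> \<open>Iterating \<open>f\<close> from 0 selects a subsequence whose consecutive
    differences \<open>C k\<close> are all outside \<open>\<J>\<close>.\<close>
  define s where "s k = (f ^^ k) 0" for k
  have "strict_mono s"
    using f(1) unfolding s_def by (simp add: strict_mono_Suc_iff)
  then have s_le: "n \<le> s n" and s_mono: "m \<le> n \<Longrightarrow> s m \<le> s n" for m n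
    by (simp_all add: strict_mono_imp_increasing strict_mono_less_eq)
  define C where "C k = a (s (Suc k)) - a (s k)" for k
  have C: "C k \<notin> \<J>" for k
    using f(2) unfolding C_def s_def by simp
  have disj_less: "C j \<inter> C k = {}" if "j < k" for j k
    using mono[OF s_mono[of "Suc j" k]] that unfolding C_def by auto
  then have disj: "C j \<inter> C k = {}" if "j \<noteq> k" for j k
    using that by (metis inf_commute linorder_neqE_nat)
  \<comment> \<open>If \<open>g n\<close> captured such a \<open>V\<close> modulo
    \<open>\<J>\<close>, a late \<open>C j\<close> inside \<open>V\<close> would be disjoint from
    \<open>g n\<close>, hence contained in \<open>V - g n\<close> and so in
    \<open>\<J>\<close>.\<close>
  have infinitely_many: False if V: "V \<in> \<I>" "\<And>n. \<exists>j\<ge>n. C j \<subseteq> V" for V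
  proof -
    obtain n where n: "V - g n \<in> \<J>"
      using cofin[OF V(1)] by blast
    obtain j where j: "n \<le> j" "C j \<subseteq> V"
      using V(2) by blast
    have "g n \<subseteq> a (s j)"
      using ga[of n] mono[of n "s j"] s_le[of j] j(1) by force
    then have "C j \<subseteq> V - g n"
      using j(2) unfolding C_def by blast
    then show False
      using ideal_on_subset[OF assms(3) n] C by blast
  qed
  \<comment> \<open>\<open>U\<close> collects the even blocks, and its complement contains the odd
    ones. Both thus contain arbitrarily late blocks, yet maximality puts one of them in
    \<open>\<I>\<close>.\<close>
  define U where "U = (\<Union>k. C (2 * k))"
  have CX: "C k \<subseteq> X" for k
    using ideal_on_carrier[OF I a] unfolding C_def by blast
  have "C (2 * n + 1) \<subseteq> X - U" for n
  proof -
    have "C (2 * n + 1) \<inter> C (2 * k) = {}" for k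
      by (rule disj) presburger
    then show ?thesis
      using CX unfolding U_def by blast
  qed
  moreover have "C (2 * n) \<subseteq> U" for n
    unfolding U_def by blast
  moreover have "n \<le> 2 * n" "n \<le> 2 * n + 1" for n :: nat
    by simp_all
  ultimately have "U \<notin> \<I>" "X - U \<notin> \<I>"
    using infinitely_many[of U] infinitely_many[of "X - U"] by blast+
  moreover have "U \<subseteq> X"
    using CX unfolding U_def by blast
  ultimately show False
    using maximal_ideal_on_compl[OF assms(1,2)] by blast
qed

text \<open>Whatever a member of \<open>\<I>\<close> has outside \<open>X - B\<close> lies in
  \<open>B\<close>, which is in \<open>\<J>\<close>.\<close>

lemma cofinal_mod_singleton_compl:
  assumes "ideal_on X \<I>" "ideal_on X \<J>" "B \<in> \<J>" "X - B \<in> \<I>"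
  shows "cofinal_mod \<J> \<I> {X - B}"
proof -
  have "I - (X - B) \<in> \<J>" if "I \<in> \<I>" for I
    by (rule ideal_on_subset[OF assms(2,3)]) (use ideal_on_carrier[OF assms(1) that] in blast)
  then show ?thesis
    using assms(4) unfolding cofinal_mod_singleton by blast
qed

theorem proposition6p3:
  fixes X :: "'a set" and \<I> \<J> :: "'a set set"
  assumes "infinite X" and "ideal_on X \<I>" and "ideal_on X \<J>"
  shows "(maximal_ideal_on X \<J> \<longrightarrow> cof \<J> \<I> =o cone) \<and>
    (maximal_ideal_on X \<I> \<longrightarrow>
       (cof \<J> \<I> =o cone \<longleftrightarrow> cof \<J> \<I> \<le>o natLeq) \<and>
       (cof \<J> \<I> \<le>o natLeq \<longleftrightarrow> restr_subset X \<I> \<J>) \<and>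
       (restr_subset X \<I> \<J> \<longleftrightarrow> \<not> \<J> \<subseteq> \<I> \<or> restr_subset X \<I> \<J>) \<and>
       (\<not> \<J> \<subseteq> \<I> \<or> restr_subset X \<I> \<J> \<longleftrightarrow>
          \<not> \<J> \<subseteq> \<I> \<or> (\<J> \<subseteq> \<I> \<and> restr_subset X \<I> \<J>)))"
proof (rule conjI; rule impI)
  assume max: "maximal_ideal_on X \<J>"
  have "\<exists>A. cofinal_mod \<J> \<I> {A}"
  proof (cases "\<I> \<subseteq> \<J>")
    case True
    then have "cofinal_mod \<J> \<I> {{}}"
      using ideal_on_empty[OF assms(2)] unfolding cofinal_mod_singleton by auto
    then show ?thesis ..
  next
    case False
    then obtain A where A: "A \<in> \<I>" "A \<notin> \<J>"
      by blast
    have "A \<subseteq> X"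
      by (rule ideal_on_carrier[OF assms(2) A(1)])
    \<comment> \<open>The set in \<open>\<J>\<close> with complement in \<open>\<I>\<close> is here
      \<open>X - A\<close>.\<close>
    then have "X - A \<in> \<J>" "X - (X - A) \<in> \<I>"
      using maximal_ideal_on_compl[OF assms(1) max] A by (simp_all add: double_diff)
    then show ?thesis
      using cofinal_mod_singleton_compl[OF assms(2,3)] by blast
  qed
  then show "cof \<J> \<I> =o cone"
    using cof_eq_cone[OF assms(2,3)] by blast
next
  assume max: "maximal_ideal_on X \<I>"
  have "cof \<J> \<I> \<le>o natLeq" if "cof \<J> \<I> =o cone"
  proof -
    have "cone \<le>o |UNIV :: nat set|"
      unfolding cone_def by (rule card_of_singl_ordLeq) simp
    then have "cone \<le>o natLeq"
      by (rule ordLeq_ordIso_trans[OF _ card_of_nat])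
    then show ?thesis
      by (rule ordIso_ordLeq_trans[OF that])
  qed
  moreover have "restr_subset X \<I> \<J>" if le: "cof \<J> \<I> \<le>o natLeq"
  proof -
    obtain g :: "nat \<Rightarrow> 'a set" where "cofinal_mod \<J> \<I> (range g)"
      using cofinal_mod_sequence[OF assms(2,3) le] .
    from cofinal_mod_sequence_collapses[OF assms(1) max assms(3) this] show ?thesis
      unfolding restr_subset_iff_cofinal_singleton[OF assms(2)] .
  qed
  moreover have "cof \<J> \<I> =o cone" if "restr_subset X \<I> \<J>"
    using that cof_eq_cone[OF assms(2,3)] restr_subset_iff_cofinal_singleton[OF assms(2)] by blast
  moreover have "restr_subset X \<I> \<J>" if "\<not> \<J> \<subseteq> \<I>"
  proof -
    obtain B where B: "B \<in> \<J>" "B \<notin> \<I>"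
      using \<open>\<not> \<J> \<subseteq> \<I>\<close> by blast
    have "X - B \<in> \<I>"
      by (rule maximal_ideal_on_compl[OF assms(1) max ideal_on_carrier[OF assms(3) B(1)] B(2)])
    then show ?thesis
      using cofinal_mod_singleton_compl[OF assms(2,3) B(1)]
        restr_subset_iff_cofinal_singleton[OF assms(2)] by blast
  qed
  \<comment> \<open>The first three conditions imply one another in a cycle, and
    \<open>\<not> \<J> \<subseteq> \<I>\<close> implies the third; the rest is
    propositional.\<close>
  ultimately show "(cof \<J> \<I> =o cone \<longleftrightarrow> cof \<J> \<I> \<le>o natLeq) \<and>
       (cof \<J> \<I> \<le>o natLeq \<longleftrightarrow> restr_subset X \<I> \<J>) \<and>
       (restr_subset X \<I> \<J> \<longleftrightarrow> \<not> \<J> \<subseteq> \<I> \<or> restr_subset X \<I> \<J>) \<and>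
       (\<not> \<J> \<subseteq> \<I> \<or> restr_subset X \<I> \<J> \<longleftrightarrow>
          \<not> \<J> \<subseteq> \<I> \<or> (\<J> \<subseteq> \<I> \<and> restr_subset X \<I> \<J>))"
    by blast
qed

end
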